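(* (1) In the non-deterministic bang calculus, with $\to\,=\,\to_\oplus\cup\to_{!\beta}$, least-level factorization holds: $\to^*\subseteq\to_{\ell\ell}^*\cdot\to_{\neg\ell\ell}^*$. (2) Least-level factorization holds in the non-deterministic CbN calculus $(\Lambda_\oplus,\to_\oplus\cup\to_\beta)$ and in the non-deterministic CbV calculus $(\Lambda_\oplus,\to_\oplus\cup\to_{\beta_v})$.
   Context: $\oplus$ is a binary operator. $\lambda$-terms $t ::= x\mid\lambda x.t\mid ts\mid\oplus(t_1,t_2)$ (set $\Lambda_\oplus$; values = variables and abstractions), contexts $c ::= [\cdot]\mid tc\mid ct\mid\lambda x.c\mid\oplus(c,t)\mid\oplus(t,c)$. Bang terms $T ::= x\mid\lambda x.T\mid TS\mid !T\mid\oplus(T_1,T_2)$, contexts $C ::= [\cdot]\mid\lambda x.C\mid TC\mid CT\mid !C\mid\oplus(C,T)\mid\oplus(T,C)$. Rules (contextually closed): $(\lambda x.t)s\mapsto_\beta t[s/x]$; $(\lambda x.t)v\mapsto_{\beta_v}t[v/x]$ ($v$ value); $(\lambda x.T)\,!S\mapsto_{!\beta}T[S/x]$; $\oplus(P,Q)\mapsto_\oplus P$ and $\oplus(P,Q)\mapsto_\oplus Q$ (on both kinds of terms). Levels of contexts: bang: $0$ at hole, $+1$ under $!$ and under $\oplus$, unchanged under $\lambda$ and application; CbN: $0$ at hole, unchanged under $\lambda x.c$ and $ct$, $+1$ under $tc$ and under $\oplus$; CbV: $0$ at hole, $+1$ under $\lambda x.c$, level of $ct$ equals that of $c'$ if $c=\lambda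 x.c'$ and that of $c$ otherwise, unchanged under $tc$, $+1$ under $\oplus$. In each calculus, the least level of a term is the infimum (in $\mathbb{N}\cup\{\infty\}$) of the levels of $C$ over decompositions $C[R]$ with $R$ a redex of the calculus' reduction (the $\oplus$-redexes together with the $!\beta$-, $\beta$-, resp. $\beta_v$-redexes); a step $C[R]\to C[R']$ is least-level ($\to_{\ell\ell}$) if the level of $C$ equals the least level of $C[R]$ and internal ($\to_{\neg\ell\ell}$) if strictly greater. Least-level factorization means $\to^*\subseteq\to_{\ell\ell}^*\cdot\to_{\neg\ell\ell}^*$ ($\cdot$ composition). *)

theory Defs
  imports Main "HOL-Library.Extended_Nat"
begin

section \<open>Contextual closure and levels\<close>

text \<open>
  A calculus is given by the (capturing) hole-filling function \<open>plug\<close> of its contexts, a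
  level function on contexts and a relation \<open>rule\<close> of root reductions.
\<close>

definition ctx_closure :: "('c \<Rightarrow> 't \<Rightarrow> 't) \<Rightarrow> ('t \<Rightarrow> 't \<Rightarrow> bool) \<Rightarrow> 't \<Rightarrow> 't \<Rightarrow> bool" where
  "ctx_closure plug rule t s \<longleftrightarrow> (\<exists>C R R'. t = plug C R \<and> s = plug C R' \<and> rule R R')"

definition redex :: "('t \<Rightarrow> 't \<Rightarrow> bool) \<Rightarrow> 't \<Rightarrow> bool" where
  "redex rule R \<longleftrightarrow> (\<exists>R'. rule R R')"

text \<open>The infimum is \<open>\<infinity>\<close> if the term has no redex.\<close>

definition least_level ::
  "('c \<Rightarrow> 't \<Rightarrow> 't) \<Rightarrow> ('c \<Rightarrow> nat) \<Rightarrow> ('t \<Rightarrow> 't \<Rightarrow> bool) \<Rightarrow> 't \<Rightarrow> enat" where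
  "least_level plug level rule t =
     Inf {enat (level C) | C R. t = plug C R \<and> redex rule R}"

definition ll_step ::
  "('c \<Rightarrow> 't \<Rightarrow> 't) \<Rightarrow> ('c \<Rightarrow> nat) \<Rightarrow> ('t \<Rightarrow> 't \<Rightarrow> bool) \<Rightarrow> 't \<Rightarrow> 't \<Rightarrow> bool" where
  "ll_step plug level rule t s \<longleftrightarrow>
     (\<exists>C R R'. t = plug C R \<and> s = plug C R' \<and> rule R R' \<and>
        enat (level C) = least_level plug level rule t)"

definition internal_step ::
  "('c \<Rightarrow> 't \<Rightarrow> 't) \<Rightarrow> ('c \<Rightarrow> nat) \<Rightarrow> ('t \<Rightarrow> 't \<Rightarrow> bool) \<Rightarrow> 't \<Rightarrow> 't \<Rightarrow> bool" where
  "internal_step plug level rule t s \<longleftrightarrow>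
     (\<exists>C R R'. t = plug C R \<and> s = plug C R' \<and> rule R R' \<and>
        enat (level C) > least_level plug level rule t)"


section \<open>Terms with a binary operator\<close>

text \<open>
  Terms up to renaming of bound variables are represented with de Bruijn indices; \<open>Op\<close> stands for
  \<open>\<oplus>\<close>. The substitution function \<open>subst t s k\<close> replaces index \<open>k\<close> by \<open>s\<close> and decrements the
  indices above \<open>k\<close>, because it is used to contract the binder that \<open>k\<close> refers to.
\<close>

datatype tm =
    Var nat
  | Lam tm
  | App tm tm
  | Op tm tm

primrec lift :: "tm \<Rightarrow> nat \<Rightarrow> tm" where
  "lift (Var i) k = (if i < k then Var i else Var (Suc i))"
| "lift (Lam t) k = Lam (lift t (Suc k))"
| "lift (App t s) k = App (lift t k) (lift s k)"
| "lift (Op t s) k = Op (lift t k) (lift s k)"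

primrec subst :: "tm \<Rightarrow> tm \<Rightarrow> nat \<Rightarrow> tm" where
  "subst (Var i) s k = (if k < i then Var (i - 1) else if i = k then s else Var i)"
| "subst (Lam t) s k = Lam (subst t (lift s 0) (Suc k))"
| "subst (App t u) s k = App (subst t s k) (subst u s k)"
| "subst (Op t u) s k = Op (subst t s k) (subst u s k)"

primrec is_value :: "tm \<Rightarrow> bool" where
  "is_value (Var i) = True"
| "is_value (Lam t) = True"
| "is_value (App t s) = False"
| "is_value (Op t s) = False"

inductive beta :: "tm \<Rightarrow> tm \<Rightarrow> bool" where
  "beta (App (Lam t) s) (subst t s 0)"

inductive beta_v :: "tm \<Rightarrow> tm \<Rightarrow> bool" where
  "is_value v \<Longrightarrow> beta_v (App (Lam t) v) (subst t v 0)"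

inductive oplus :: "tm \<Rightarrow> tm \<Rightarrow> bool" where
  "oplus (Op p q) p"
| "oplus (Op p q) q"

datatype ctx =
    Hole
  | CLam ctx
  | CAppL ctx tm
  | CAppR tm ctx
  | COpL ctx tm
  | COpR tm ctx

primrec plug :: "ctx \<Rightarrow> tm \<Rightarrow> tm" where
  "plug Hole r = r"
| "plug (CLam c) r = Lam (plug c r)"
| "plug (CAppL c t) r = App (plug c r) t"
| "plug (CAppR t c) r = App t (plug c r)"
| "plug (COpL c t) r = Op (plug c r) t"
| "plug (COpR t c) r = Op t (plug c r)"

primrec cbn_level :: "ctx \<Rightarrow> nat" where
  "cbn_level Hole = 0"
| "cbn_level (CLam c) = cbn_level c"
| "cbn_level (CAppL c t) = cbn_level c"
| "cbn_level (CAppR t c) = Suc (cbn_level c)"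
| "cbn_level (COpL c t) = Suc (cbn_level c)"
| "cbn_level (COpR t c) = Suc (cbn_level c)"

fun cbv_level :: "ctx \<Rightarrow> nat" where
  "cbv_level Hole = 0"
| "cbv_level (CLam c) = Suc (cbv_level c)"
| "cbv_level (CAppL (CLam c) t) = cbv_level c"
| "cbv_level (CAppL c t) = cbv_level c"
| "cbv_level (CAppR t c) = cbv_level c"
| "cbv_level (COpL c t) = Suc (cbv_level c)"
| "cbv_level (COpR t c) = Suc (cbv_level c)"


section \<open>Bang terms\<close>

datatype btm =
    BVar nat
  | BLam btm
  | BApp btm btm
  | Bang btm
  | BOp btm btm

primrec blift :: "btm \<Rightarrow> nat \<Rightarrow> btm" where
  "blift (BVar i) k = (if i < k then BVar i else BVar (Suc i))"
| "blift (BLam t) k = BLam (blift t (Suc k))"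
| "blift (BApp t s) k = BApp (blift t k) (blift s k)"
| "blift (Bang t) k = Bang (blift t k)"
| "blift (BOp t s) k = BOp (blift t k) (blift s k)"

primrec bsubst :: "btm \<Rightarrow> btm \<Rightarrow> nat \<Rightarrow> btm" where
  "bsubst (BVar i) s k = (if k < i then BVar (i - 1) else if i = k then s else BVar i)"
| "bsubst (BLam t) s k = BLam (bsubst t (blift s 0) (Suc k))"
| "bsubst (BApp t u) s k = BApp (bsubst t s k) (bsubst u s k)"
| "bsubst (Bang t) s k = Bang (bsubst t s k)"
| "bsubst (BOp t u) s k = BOp (bsubst t s k) (bsubst u s k)"

inductive bang_beta :: "btm \<Rightarrow> btm \<Rightarrow> bool" where
  "bang_beta (BApp (BLam t) (Bang s)) (bsubst t s 0)"

inductive bang_oplus :: "btm \<Rightarrow> btm \<Rightarrow> bool" where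
  "bang_oplus (BOp p q) p"
| "bang_oplus (BOp p q) q"

datatype bctx =
    BHole
  | BCLam bctx
  | BCAppL bctx btm
  | BCAppR btm bctx
  | BCBang bctx
  | BCOpL bctx btm
  | BCOpR btm bctx

primrec bplug :: "bctx \<Rightarrow> btm \<Rightarrow> btm" where
  "bplug BHole r = r"
| "bplug (BCLam c) r = BLam (bplug c r)"
| "bplug (BCAppL c t) r = BApp (bplug c r) t"
| "bplug (BCAppR t c) r = BApp t (bplug c r)"
| "bplug (BCBang c) r = Bang (bplug c r)"
| "bplug (BCOpL c t) r = BOp (bplug c r) t"
| "bplug (BCOpR t c) r = BOp t (bplug c r)"

primrec bang_level :: "bctx \<Rightarrow> nat" where
  "bang_level BHole = 0"
| "bang_level (BCLam c) = bang_level c"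
| "bang_level (BCAppL c t) = bang_level c"
| "bang_level (BCAppR t c) = bang_level c"
| "bang_level (BCBang c) = Suc (bang_level c)"
| "bang_level (BCOpL c t) = Suc (bang_level c)"
| "bang_level (BCOpR t c) = Suc (bang_level c)"


section \<open>Non-deterministic calculi\<close>

abbreviation bang_root :: "btm \<Rightarrow> btm \<Rightarrow> bool" where
  "bang_root \<equiv> sup bang_oplus bang_beta"

abbreviation cbn_root :: "tm \<Rightarrow> tm \<Rightarrow> bool" where
  "cbn_root \<equiv> sup oplus beta"

abbreviation cbv_root :: "tm \<Rightarrow> tm \<Rightarrow> bool" where
  "cbv_root \<equiv> sup oplus beta_v"

definition bang_red :: "btm \<Rightarrow> btm \<Rightarrow> bool" where
  "bang_red = sup (ctx_closure bplug bang_oplus) (ctx_closure bplug bang_beta)"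

definition cbn_red :: "tm \<Rightarrow> tm \<Rightarrow> bool" where
  "cbn_red = sup (ctx_closure plug oplus) (ctx_closure plug beta)"

definition cbv_red :: "tm \<Rightarrow> tm \<Rightarrow> bool" where
  "cbv_red = sup (ctx_closure plug oplus) (ctx_closure plug beta_v)"

definition ll_factorization ::
  "('t \<Rightarrow> 't \<Rightarrow> bool) \<Rightarrow> ('t \<Rightarrow> 't \<Rightarrow> bool) \<Rightarrow> ('t \<Rightarrow> 't \<Rightarrow> bool) \<Rightarrow> bool" where
  "ll_factorization red ll nll \<longleftrightarrow> red\<^sup>*\<^sup>* \<le> ll\<^sup>*\<^sup>* OO nll\<^sup>*\<^sup>*"

end

theory Submission
  imports Defs
begin

text \<open>
  Let \<open>std n t s\<close> mean that \<open>n\<close> contractions lead from \<open>t\<close> to \<open>s\<close> head-first: either a root redex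
  is contracted and one continues, or one descends into the immediate subterms for good. Restricting
  the contracted redexes to level \<open>k\<close> or more gives \<open>par k\<close>.
  Either \<open>std n t s\<close> is of the form \<open>par (Suc k) t s\<close>, where \<open>k\<close> is the least level of \<open>t\<close>, or it
  performs a contraction of level at most \<open>k\<close>, hence \<open>k\<close>, and this step can be executed first at the
  price of decreasing \<open>n\<close>; so \<open>std\<close> splits into least-level steps followed by internal ones.
  Conversely, contractions of level above \<open>k\<close> neither create nor destroy redexes of level at most
  \<open>k\<close>, so an internal \<open>par\<close> followed by a least-level step merges into a single \<open>std\<close>. Splitting
  again moves least-level steps to the front.
\<close>

section \<open>Factorization from splitting and merging\<close>

text \<open>Indexing steps by their level lets the least level, \<open>ll_step\<close> and
  \<open>internal_step\<close> be handled by comparing numbers, with contexts out of sight.\<close>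

definition step_at ::
  "('c \<Rightarrow> 't \<Rightarrow> 't) \<Rightarrow> ('c \<Rightarrow> nat) \<Rightarrow> ('t \<Rightarrow> 't \<Rightarrow> bool) \<Rightarrow> nat \<Rightarrow> 't \<Rightarrow> 't \<Rightarrow> bool" where
  "step_at fill level rule j t s \<longleftrightarrow>
     (\<exists>C R R'. t = fill C R \<and> s = fill C R' \<and> rule R R' \<and> level C = j)"

lemma ctx_closure_iff_step_at:
  "ctx_closure fill rule t s \<longleftrightarrow> (\<exists>j. step_at fill level rule j t s)"
  by (auto simp: ctx_closure_def step_at_def)

lemma ctx_closure_sup:
  "sup (ctx_closure fill r) (ctx_closure fill r') = ctx_closure fill (sup r r')"
  by (auto simp: ctx_closure_def fun_eq_iff)

lemma least_level_eq:
  "least_level fill level rule t = Inf {enat j | j s. step_at fill level rule j t s}"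
  unfolding least_level_def step_at_def redex_def by (rule arg_cong[where f = Inf]) blast

lemma ll_stepI:
  assumes "step_at fill level rule j t s"
    and "\<And>i u. step_at fill level rule i t u \<Longrightarrow> j \<le> i"
  shows "ll_step fill level rule t s"
proof -
  have "least_level fill level rule t = enat j"
    unfolding least_level_eq
    by (rule antisym) (use assms in \<open>auto intro!: Inf_lower Inf_greatest\<close>)
  with assms(1) show ?thesis
    unfolding ll_step_def step_at_def by metis
qed

lemma ll_stepE:
  assumes "ll_step fill level rule t s"
  obtains j where "step_at fill level rule j t s"
    and "\<And>i u. step_at fill level rule i t u \<Longrightarrow> j \<le> i"
proof -
  obtain C R R' where C: "t = fill C R" "s = fill C R'" "rule R R'"
    "enat (level C) = least_level fill level rule t"
    using assms unfolding ll_step_def by blast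
  have "level C \<le> i" if "step_at fill level rule i t u" for i u
  proof -
    have "least_level fill level rule t \<le> enat i"
      unfolding least_level_eq by (rule Inf_lower) (use that in blast)
    then show ?thesis unfolding C(4)[symmetric] by simp
  qed
  with C show thesis
    using that[of "level C"] unfolding step_at_def by blast
qed

text \<open>A single redex of smaller level bounds the infimum strictly, so the least level itself
  need not be computed.\<close>

lemma internal_stepI:
  assumes "step_at fill level rule j t s" "step_at fill level rule i t u" "i < j"
  shows "internal_step fill level rule t s"
proof -
  have "least_level fill level rule t < enat j"
    unfolding least_level_eq Inf_less_iff using assms(2,3) enat_ord_simps(2) by blast
  with assms(1) show ?thesis
    unfolding internal_step_def step_at_def by metis
qed

text \<open>Interface of which each of the three calculi is an instance. In \<open>std_split\<close>
  the decrease \<open>m < n\<close> is the measure by which low steps are extracted one at a time;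
  \<open>par_merge\<close> concerns low redexes of the target, \<open>par_persist\<close> those of
  the source.\<close>

locale leveled_standardization =
  fixes fill :: "'c \<Rightarrow> 't \<Rightarrow> 't" and level :: "'c \<Rightarrow> nat" and rule :: "'t \<Rightarrow> 't \<Rightarrow> bool"
    and std :: "nat \<Rightarrow> 't \<Rightarrow> 't \<Rightarrow> bool" and par :: "nat \<Rightarrow> 't \<Rightarrow> 't \<Rightarrow> bool"
  assumes step_par: "step_at fill level rule j t s \<Longrightarrow> k \<le> j \<Longrightarrow> par k t s"
    and par_std: "par k t s \<Longrightarrow> \<exists>n. std n t s"
    and std_split: "std n t s \<Longrightarrow>
      par k t s \<or> (\<exists>j<k. \<exists>u. step_at fill level rule j t u \<and> (\<exists>m<n. std m u s))"
    and par_merge: "par k t s \<Longrightarrow> step_at fill level rule j s u \<Longrightarrow> j < k \<Longrightarrow> \<exists>n. std n t u"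
    and par_persist: "par k t s \<Longrightarrow> step_at fill level rule j t u \<Longrightarrow> j < k \<Longrightarrow>
      \<exists>u'. step_at fill level rule j s u'"
    and par_steps: "par k t s \<Longrightarrow> (\<lambda>x y. \<exists>j\<ge>k. step_at fill level rule j x y)\<^sup>*\<^sup>* t s"
begin

abbreviation "step \<equiv> step_at fill level rule"
abbreviation "ll \<equiv> ll_step fill level rule"
abbreviation "internal \<equiv> internal_step fill level rule"

text \<open>
  The level \<open>k\<close> need only be that of some redex of \<open>t\<close>: contractions above \<open>k\<close> are then internal,
  and no invariance of the least level has to be proved.
\<close>
definition ipar :: "'t \<Rightarrow> 't \<Rightarrow> bool" where
  "ipar t s \<longleftrightarrow> t = s \<or> (\<exists>k u. step k t u \<and> par (Suc k) t s)"

text \<open>The redex of level \<open>k\<close> survives every contraction above \<open>k\<close>,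
  so at each intermediate term it witnesses that the next contraction is internal.\<close>

lemma ipar_internal:
  assumes "ipar t s"
  shows "internal\<^sup>*\<^sup>* t s"
proof -
  have "internal\<^sup>*\<^sup>* t s" if "step k t u" "par (Suc k) t s" for k u
    using par_steps[OF that(2)] that(1)
  proof (induction arbitrary: u rule: converse_rtranclp_induct)
    case base
    show ?case by simp
  next
    case (step x y)
    then obtain j where j: "j \<ge> Suc k" "step j x y" by blast
    have "internal x y"
      using internal_stepI[OF j(2) step.prems] j(1) by simp
    \<comment> \<open>A single step above \<open>k\<close> is itself a \<open>par (Suc k)\<close>,
      so \<open>par_persist\<close> carries the witness across it.\<close>
    moreover obtain u' where "step k y u'"
      using par_persist[OF step_par[OF j(2,1)] step.prems] by auto
    ultimately show ?case
      using step.IH by (blast intro: converse_rtranclp_into_rtranclp)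
  qed
  with assms show ?thesis by (auto simp: ipar_def)
qed

lemma std_ll_ipar:
  assumes "std n t s"
  shows "(ll\<^sup>*\<^sup>* OO ipar) t s"
  using assms
proof (induction n arbitrary: t rule: less_induct)
  case (less n)
  show ?case
  proof (cases "\<exists>j u. step j t u")
    case False
    \<comment> \<open>With no step out of \<open>t\<close>, the split can only yield
      \<open>par k\<close>, whose unfolding into steps must be empty.\<close>
    with std_split[OF less.prems] have "par k t s" for k by blast
    from par_steps[OF this[of 0]] False have "t = s"
      by (auto elim: converse_rtranclpE)
    then show ?thesis by (auto simp: ipar_def)
  next
    case True
    define k where "k = (LEAST j. \<exists>u. step j t u)"
    have k: "\<exists>u. step k t u"
      unfolding k_def by (rule LeastI_ex) (rule True)
    have min: "k \<le> i" if "step i t u" for i u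
      unfolding k_def by (rule Least_le) (use that in blast)
    from std_split[OF less.prems, of "Suc k"] show ?thesis
    proof
      assume "par (Suc k) t s"
      with k show ?thesis by (auto simp: ipar_def)
    next
      assume "\<exists>j<Suc k. \<exists>u. step j t u \<and> (\<exists>m<n. std m u s)"
      then obtain j u m where u: "j < Suc k" "step j t u" "m < n" "std m u s" by blast
      have "ll t u"
        using u(1) min by (intro ll_stepI[OF u(2)]) fastforce
      moreover obtain w where "ll\<^sup>*\<^sup>* u w" "ipar w s"
        using less.IH[OF u(3,4)] by blast
      ultimately show ?thesis
        by (blast intro: converse_rtranclp_into_rtranclp)
    qed
  qed
qed

text \<open>Here internal and least-level steps change order: merging turns the pair into one
  \<open>std\<close>, and splitting that puts the least-level steps first.\<close>

lemma ipar_ll: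
  assumes "ipar t s" "ll s u"
  shows "(ll\<^sup>*\<^sup>* OO ipar) t u"
proof -
  from assms(2) obtain j where j: "step j s u" "\<And>i u. step i s u \<Longrightarrow> j \<le> i"
    by (rule ll_stepE) blast
  have "\<exists>n. std n t u"
  proof (cases "t = s")
    case True
    with j(1) show ?thesis
      using step_par[of j t u 0] par_std by blast
  next
    case False
    then obtain k u' where k: "step k t u'" "par (Suc k) t s"
      using assms(1) by (auto simp: ipar_def)
    \<comment> \<open>The redex of level \<open>k\<close> persists to \<open>s\<close>, so the
      least-level step from \<open>s\<close> has level \<open>j \<le> k\<close>, as merging at bound
      \<open>Suc k\<close> requires.\<close>
    obtain u'' where "step k s u''"
      using par_persist[OF k(2,1)] by auto
    with j show ?thesis
      using par_merge[OF k(2) j(1)] by fastforce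
  qed
  then show ?thesis using std_ll_ipar by blast
qed

lemma ipar_lls:
  assumes "ll\<^sup>*\<^sup>* s u" "ipar t s"
  shows "(ll\<^sup>*\<^sup>* OO ipar) t u"
  using assms
proof (induction arbitrary: t rule: converse_rtranclp_induct)
  case base
  then show ?case by blast
next
  case (step s s')
  from ipar_ll[OF step.prems step.hyps(1)] obtain t' where t': "ll\<^sup>*\<^sup>* t t'" "ipar t' s'" by blast
  from step.IH[OF t'(2)] obtain w where "ll\<^sup>*\<^sup>* t' w" "ipar w u" by blast
  with t'(1) show ?case by (blast intro: rtranclp_trans)
qed

text \<open>The tail of the reduction is factorized first; the first step is then split, and its
  \<open>ipar\<close> part is carried past the least-level prefix of the tail. Each round leaves one
  more \<open>ipar\<close>, so these are expanded into internal steps only at the end.\<close>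

lemma factorization: "ll_factorization (ctx_closure fill rule) ll internal"
proof -
  have "(ll\<^sup>*\<^sup>* OO ipar\<^sup>*\<^sup>*) t s" if "(ctx_closure fill rule)\<^sup>*\<^sup>* t s" for t s
    using that
  proof (induction rule: converse_rtranclp_induct)
    case base
    show ?case by blast
  next
    case (step x y)
    then obtain y' where y': "ll\<^sup>*\<^sup>* y y'" "ipar\<^sup>*\<^sup>* y' s" by blast
    obtain j where "step_at fill level rule j x y"
      using step.hyps(1) ctx_closure_iff_step_at by metis
    then obtain n where "std n x y"
      using step_par[of j x y 0] par_std by blast
    then obtain x' where x': "ll\<^sup>*\<^sup>* x x'" "ipar x' y"
      using std_ll_ipar by blast
    obtain z where "ll\<^sup>*\<^sup>* x' z" "ipar z y'"
      using ipar_lls[OF y'(1) x'(2)] by blast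
    then have "ll\<^sup>*\<^sup>* x z" "ipar\<^sup>*\<^sup>* z s"
      using x'(1) y'(2) by (blast intro: rtranclp_trans, blast intro: converse_rtranclp_into_rtranclp)
    then show ?case by blast
  qed
  moreover have "internal\<^sup>*\<^sup>* t s" if "ipar\<^sup>*\<^sup>* t s" for t s
    using that by induction (auto dest: ipar_internal)
  ultimately show ?thesis
    unfolding ll_factorization_def by blast
qed

end


section \<open>Call-by-name and call-by-value\<close>

text \<open>
  The Boolean \<open>v\<close> selects call-by-value. The Boolean \<open>f\<close> below tells that the term is in function
  position, where in call-by-value an abstraction does not increase the level.
\<close>
definition root :: "bool \<Rightarrow> tm \<Rightarrow> tm \<Rightarrow> bool" where
  "root v = (if v then cbv_root else cbn_root)"

lemma root_iff:
  "root v t s \<longleftrightarrow> (\<exists>p q. t = Op p q \<and> (s = p \<or> s = q)) \<or>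
     (\<exists>p q. t = App (Lam p) q \<and> s = subst p q 0 \<and> (v \<longrightarrow> is_value q))"
  by (auto simp: root_def oplus.simps beta.simps beta_v.simps)

section \<open>De Bruijn substitution and stability of root reductions\<close>

lemma lift_lift: "i < Suc k \<Longrightarrow> lift (lift t i) (Suc k) = lift (lift t k) i"
  by (induction t arbitrary: i k) auto

lemma lift_subst:
  "j < Suc i \<Longrightarrow> lift (subst t s j) i = subst (lift t (Suc i)) (lift s i) j"
  by (induction t arbitrary: i j s) (simp_all add: diff_Suc lift_lift split: nat.split)

lemma lift_subst_lt:
  "i < Suc j \<Longrightarrow> lift (subst t s j) i = subst (lift t i) (lift s i) (Suc j)"
  by (induction t arbitrary: i j s) (auto simp: lift_lift)

lemma subst_lift: "subst (lift t k) s k = t"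
  by (induction t arbitrary: k s) simp_all

text \<open>The substitution lemma t[q/y][p[q/y]/x] = t[p/x][q/y], with \<open>i\<close> the index
  of x; at \<open>i = 0\<close> it commutes a contraction with a substitution.\<close>

lemma subst_subst:
  "i < Suc j \<Longrightarrow>
     subst (subst t (lift q i) (Suc j)) (subst p q j) i = subst (subst t p i) q j"
  by (induction t arbitrary: i j p q)
    (simp_all add: diff_Suc subst_lift lift_lift[symmetric] lift_subst_lt split: nat.split)

lemma is_value_lift [simp]: "is_value (lift t k) = is_value t"
  by (cases t) auto

lemma is_value_subst: "is_value t \<Longrightarrow> is_value s \<Longrightarrow> is_value (subst t s k)"
  by (cases t) auto

lemma root_lift: "root v t s \<Longrightarrow> root v (lift t k) (lift s k)"
  by (auto simp: root_iff lift_subst)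

text \<open>In call-by-value a redex may have a variable as argument; only a value put in its place
  keeps the redex.\<close>

lemma root_subst: "root v t s \<Longrightarrow> v \<longrightarrow> is_value q \<Longrightarrow> root v (subst t q k) (subst s q k)"
  unfolding root_iff
  by (elim disjE exE conjE) (simp_all add: subst_subst[where i = 0, symmetric] is_value_subst)

text \<open>\<open>cbv_level\<close> looks one constructor ahead below \<open>CAppL\<close>;
  carrying the flag \<open>f\<close> downwards replaces this lookahead and makes levels
  compositional.\<close>

inductive step :: "bool \<Rightarrow> bool \<Rightarrow> nat \<Rightarrow> tm \<Rightarrow> tm \<Rightarrow> bool" for v where
  root: "root v t s \<Longrightarrow> step v f 0 t s"
| lam: "step v False k t s \<Longrightarrow> step v f (if v \<and> \<not> f then Suc k else k) (Lam t) (Lam s)"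
| appl: "step v True k t s \<Longrightarrow> step v f k (App t u) (App s u)"
| appr: "step v False k t s \<Longrightarrow> step v f (if v then k else Suc k) (App u t) (App u s)"
| opl: "step v False k t s \<Longrightarrow> step v f (Suc k) (Op t u) (Op s u)"
| opr: "step v False k t s \<Longrightarrow> step v f (Suc k) (Op u t) (Op u s)"

text \<open>
  The rule \<open>root\<close> continues from the contractum instead of developing the components of the redex in
  parallel. This makes substitutivity of \<open>std\<close> provable without counting occurrences.
\<close>
inductive std :: "bool \<Rightarrow> nat \<Rightarrow> tm \<Rightarrow> tm \<Rightarrow> bool" for v where
  root: "root v t u \<Longrightarrow> std v n u s \<Longrightarrow> std v (Suc n) t s"
| var: "std v 0 (Var i) (Var i)"
| lam: "std v n t s \<Longrightarrow> std v n (Lam t) (Lam s)"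
| app: "std v n t s \<Longrightarrow> std v m t' s' \<Longrightarrow> std v (n + m) (App t t') (App s s')"
| op: "std v n t s \<Longrightarrow> std v m t' s' \<Longrightarrow> std v (n + m) (Op t t') (Op s s')"

inductive par :: "bool \<Rightarrow> bool \<Rightarrow> nat \<Rightarrow> tm \<Rightarrow> tm \<Rightarrow> bool" for v where
  std: "std v n t s \<Longrightarrow> par v f 0 t s"
| var: "par v f (Suc k) (Var i) (Var i)"
| lam: "par v False (if v \<and> \<not> f then k else Suc k) t s \<Longrightarrow> par v f (Suc k) (Lam t) (Lam s)"
| app: "par v True (Suc k) t s \<Longrightarrow> par v False (if v then Suc k else k) t' s' \<Longrightarrow>
    par v f (Suc k) (App t t') (App s s')"
| op: "par v False k t s \<Longrightarrow> par v False k t' s' \<Longrightarrow> par v f (Suc k) (Op t t') (Op s s')"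

text \<open>A positive bound gives both terms the same outermost constructor, so inversion works
  from the source as well as from the target.\<close>

inductive_cases parE:
  "par v f (Suc k) (Var i) s" "par v f (Suc k) (Lam t) s" "par v f (Suc k) (App t t') s"
  "par v f (Suc k) (Op t t') s" "par v f (Suc k) t (Var i)" "par v f (Suc k) t (Lam s)"
  "par v f (Suc k) t (App s s')" "par v f (Suc k) t (Op s s')"

section \<open>Reflexivity and inclusions between \<open>step\<close>, \<open>par\<close> and
  \<open>std\<close>\<close>

lemma std_refl: "std v 0 t t"
  by (induction t) (auto intro: std.intros std.app[where n = 0 and m = 0, simplified]
      std.op[where n = 0 and m = 0, simplified])

lemma par_refl: "par v f k t t"
proof (induction t arbitrary: f k)
  case (Var i) then show ?case by (cases k) (auto intro: par.intros std_refl)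
next
  case (Lam t) then show ?case by (cases k) (auto intro: par.intros std_refl)
next
  case (App t t') then show ?case by (cases k) (auto intro: par.intros std_refl)
next
  case (Op t t') then show ?case by (cases k) (auto intro: par.intros std_refl)
qed

lemma step_std: "step v f k t s \<Longrightarrow> \<exists>n. std v n t s"
  by (induction rule: step.induct) (blast intro: std.intros std_refl)+

lemma par_std: "par v f k t s \<Longrightarrow> \<exists>n. std v n t s"
  by (induction rule: par.induct) (blast intro: std.intros)+

text \<open>Along the descent the level of the step and the bound drop together; once the bound is
  0, the rest of the step is taken as a \<open>std\<close>.\<close>

lemma step_par: "step v f j t s \<Longrightarrow> k \<le> j \<Longrightarrow> par v f k t s"
proof (induction arbitrary: k rule: step.induct)
  case (root t s f)
  then show ?case using step_std[OF step.root[OF root.hyps]] by (auto intro: par.std)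
next
  case (lam j t s f)
  show ?case
  proof (cases k)
    case 0 with step_std[OF step.lam[OF lam.hyps]] show ?thesis by (blast intro: par.std)
  next
    case (Suc k')
    have "par v False (if v \<and> \<not> f then k' else Suc k') t s"
      by (rule lam.IH) (use Suc lam.prems in \<open>auto split: if_splits\<close>)
    with Suc show ?thesis by (blast intro: par.lam)
  qed
next
  case (appl j t s f u)
  show ?case
  proof (cases k)
    case 0 with step_std[OF step.appl[OF appl.hyps]] show ?thesis by (blast intro: par.std)
  next
    case Suc with appl show ?thesis by (blast intro: par.app par_refl)
  qed
next
  case (appr j t s f u)
  show ?case
  proof (cases k)
    case 0 with step_std[OF step.appr[OF appr.hyps]] show ?thesis by (blast intro: par.std)
  next
    case (Suc k')
    have "par v False (if v then Suc k' else k') t s"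
      by (rule appr.IH) (use Suc appr.prems in \<open>auto split: if_splits\<close>)
    with Suc show ?thesis by (blast intro: par.app par_refl)
  qed
next
  case (opl j t s f u)
  show ?case
  proof (cases k)
    case 0 with step_std[OF step.opl[OF opl.hyps]] show ?thesis by (blast intro: par.std)
  next
    case Suc with opl show ?thesis by (auto intro!: par.op par_refl)
  qed
next
  case (opr j t s f u)
  show ?case
  proof (cases k)
    case 0 with step_std[OF step.opr[OF opr.hyps]] show ?thesis by (blast intro: par.std)
  next
    case Suc with opr show ?thesis by (auto intro!: par.op par_refl)
  qed
qed

section \<open>Substitutivity of head-first reductions\<close>

lemma std_lift: "std v n t s \<Longrightarrow> std v n (lift t k) (lift s k)"
  by (induction arbitrary: k rule: std.induct) (auto intro: std.intros root_lift)

text \<open>Root contractions of \<open>t\<close> are performed with \<open>q\<close> still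
  unreduced, hence the value condition on \<open>q\<close>. The reduction of \<open>q\<close> is
  copied into each occurrence of the index, which is why the length is existential.\<close>

lemma std_subst:
  "std v n t s \<Longrightarrow> std v m q q' \<Longrightarrow> v \<longrightarrow> is_value q \<Longrightarrow> \<exists>l. std v l (subst t q k) (subst s q' k)"
proof (induction arbitrary: k q q' rule: std.induct)
  case (root t u n s)
  then show ?case by (blast intro: std.root root_subst)
next
  case (var i)
  then show ?case by (auto intro: std.var)
next
  case (lam n t s)
  have "v \<longrightarrow> is_value (lift q 0)" using lam.prems(2) by simp
  from lam.IH[OF std_lift[OF lam.prems(1)] this] show ?case
    by (auto intro: std.lam)
next
  case (app n t s m t' s')
  then show ?case by (simp; blast intro: std.app)
next
  case (op n t s m t' s')
  then show ?case by (simp; blast intro: std.op)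
qed

text \<open>A leading root contraction is itself the low step. Under a congruence rule the
  components reduce independently, so a low step found in one of them can go first while the other
  keeps its length.\<close>

lemma std_split:
  "std v n t s \<Longrightarrow> par v f k t s \<or> (\<exists>j<k. \<exists>u. step v f j t u \<and> (\<exists>m<n. std v m u s))"
proof (induction arbitrary: f k rule: std.induct)
  case (root t u n s)
  show ?case
  proof (cases k)
    case 0 then show ?thesis using std.root[OF root.hyps] by (auto intro: par.std)
  next
    case Suc with root.hyps show ?thesis by (blast intro: step.root)
  qed
next
  case (var i)
  show ?case using par_refl by blast
next
  case (lam n t s)
  show ?case
  proof (cases k)
    case 0 then show ?thesis using std.lam[OF lam.hyps] by (auto intro: par.std)
  next
    case (Suc k')
    \<comment> \<open>The bound is the one that \<open>par.lam\<close> asks of the body; a step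
      below it has level below \<open>k\<close> again once the abstraction is put back.\<close>
    from lam.IH[of False "if v \<and> \<not> f then k' else k"] show ?thesis
    proof
      assume "par v False (if v \<and> \<not> f then k' else k) t s"
      with Suc show ?thesis by (auto intro: par.lam)
    next
      assume "\<exists>j<if v \<and> \<not> f then k' else k. \<exists>u. step v False j t u \<and> (\<exists>m<n. std v m u s)"
      then obtain j u m where "j < (if v \<and> \<not> f then k' else k)" "step v False j t u"
        "m < n" "std v m u s" by blast
      moreover from this Suc have "(if v \<and> \<not> f then Suc j else j) < k" by (auto split: if_splits)
      ultimately show ?thesis by (blast intro: step.lam std.lam)
    qed
  qed
next
  case (app n t s m t' s')
  show ?case
  proof (cases k)
    case 0 then show ?thesis using std.app[OF app.hyps] by (auto intro: par.std)
  next
    case (Suc k')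
    from app.IH(1)[of True k] app.IH(2)[of False "if v then k else k'"]
    consider "par v True k t s" "par v False (if v then k else k') t' s'"
      | j u l where "j < k" "step v True j t u" "l < n" "std v l u s"
      | j u l where "j < (if v then k else k')" "step v False j t' u" "l < m" "std v l u s'"
      by blast
    then show ?thesis
    proof cases
      case 1
      with Suc show ?thesis by (auto intro: par.app)
    next
      case 2
      then have "l + m < n + m" by simp
      with 2 app.hyps(2) show ?thesis by (blast intro: step.appl std.app)
    next
      case 3
      then have "n + l < n + m" "(if v then j else Suc j) < k"
        using Suc by (auto split: if_splits)
      with 3 app.hyps(1) show ?thesis by (blast intro: step.appr std.app)
    qed
  qed
next
  case (op n t s m t' s')
  show ?case
  proof (cases k)
    case 0 then show ?thesis using std.op[OF op.hyps] by (auto intro: par.std)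
  next
    case (Suc k')
    from op.IH(1)[of False k'] op.IH(2)[of False k']
    consider "par v False k' t s" "par v False k' t' s'"
      | j u l where "j < k'" "step v False j t u" "l < n" "std v l u s"
      | j u l where "j < k'" "step v False j t' u" "l < m" "std v l u s'"
      by blast
    then show ?thesis
    proof cases
      case 1
      with Suc show ?thesis by (auto intro: par.op)
    next
      case 2
      then have "l + m < n + m" "Suc j < k" using Suc by auto
      with 2 op.hyps(2) show ?thesis by (blast intro: step.opl std.op)
    next
      case 3
      then have "n + l < n + m" "Suc j < k" using Suc by auto
      with 3 op.hyps(1) show ?thesis by (blast intro: step.opr std.op)
    qed
  qed
qed

section \<open>Merging and persistence of redexes below the bound\<close>

lemma par_is_value: "par v f (Suc k) t s \<Longrightarrow> is_value s \<longleftrightarrow> is_value t"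
  by (auto elim: par.cases)

text \<open>The contracted redex of \<open>s\<close> lies where \<open>par\<close> preserves
  constructors, so it stems from a redex of \<open>t\<close>. Contracting the latter first and
  reducing the components afterwards is head-first.\<close>

lemma par_merge:
  "step v f j s u \<Longrightarrow> par v f k t s \<Longrightarrow> j < k \<Longrightarrow> \<exists>n. std v n t u"
proof (induction arbitrary: t k rule: step.induct)
  case (root s u f)
  then obtain k' where k: "k = Suc k'" by (cases k) auto
  from root.hyps consider p q where "s = Op p q" "u = p \<or> u = q"
    | p q where "s = App (Lam p) q" "u = subst p q 0" "v \<longrightarrow> is_value q"
    by (auto simp: root_iff)
  then show ?case
  proof cases
    case 1
    with root.prems k obtain p' q' where t: "t = Op p' q'" "par v False k' p' p" "par v False k' q' q"
      by (auto elim: parE)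
    have "root v t p'" "root v t q'" by (simp_all add: t(1) root_iff)
    with 1 par_std[OF t(2)] par_std[OF t(3)] show ?thesis by (blast intro: std.root)
  next
    case 2
    with root.prems k obtain p' q' l where t: "t = App (Lam p') q'"
      "par v False l p' p" "par v False (if v then Suc k' else k') q' q"
      by (auto elim!: parE)
    \<comment> \<open>In call-by-value arguments keep the positive bound \<open>Suc k'\<close>, so
      being a value transfers back from \<open>q\<close> to \<open>q'\<close>.\<close>
    have v: "v \<longrightarrow> is_value q'" using 2(3) t(3) par_is_value by auto
    then have "root v t (subst p' q' 0)" by (simp add: t(1) root_iff)
    moreover obtain m where "std v m (subst p' q' 0) (subst p q 0)"
      using par_std[OF t(2)] par_std[OF t(3)] v std_subst by blast
    ultimately show ?thesis using 2(2) by (blast intro: std.root)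
  qed
next
  case (lam j s u f)
  then obtain k' where "k = Suc k'" by (cases k) auto
  with lam show ?case by (fastforce elim!: parE intro: std.lam split: if_splits)
next
  case (appl j s u f r)
  then obtain k' where "k = Suc k'" by (cases k) auto
  with appl show ?case by (blast elim!: parE intro: std.app dest: par_std)
next
  case (appr j s u f r)
  then obtain k' where k: "k = Suc k'" by (cases k) auto
  with appr.prems obtain a b where t: "t = App a b" "par v True k a r"
    "par v False (if v then k else k') b s"
    by (auto elim: parE)
  from k appr.prems(2) have "j < (if v then k else k')" by (auto split: if_splits)
  with appr.IH[OF t(3)] par_std[OF t(2)] t(1) show ?case by (blast intro: std.app)
next
  case (opl j s u f r)
  then obtain k' where "k = Suc k'" "j < k'" by (cases k) auto
  with opl show ?case by (blast elim!: parE intro: std.op dest: par_std)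
next
  case (opr j s u f r)
  then obtain k' where "k = Suc k'" "j < k'" by (cases k) auto
  with opr show ?case by (blast elim!: parE intro: std.op dest: par_std)
qed

text \<open>The same inversion read forwards. The surviving redex may have reduced components, so
  its contractum is only claimed to exist.\<close>

lemma par_persist:
  "step v f j t u \<Longrightarrow> par v f k t s \<Longrightarrow> j < k \<Longrightarrow> \<exists>u'. step v f j s u'"
proof (induction arbitrary: s k rule: step.induct)
  case (root t u f)
  then obtain k' where k: "k = Suc k'" by (cases k) auto
  with root.hyps root.prems(1) have "\<exists>u'. root v s u'"
    by (cases v) (auto simp: root_iff par_is_value elim!: parE)
  then show ?case by (blast intro: step.root)
next
  case (lam j t u f)
  then obtain k' where k: "k = Suc k'" by (cases k) auto
  with lam.prems obtain t' where t': "s = Lam t'" "par v False (if v \<and> \<not> f then k' else k) t t'"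
    by (auto elim: parE)
  from k lam.prems(2) have "j < (if v \<and> \<not> f then k' else k)" by (auto split: if_splits)
  with lam.IH[OF t'(2)] t'(1) show ?case by (blast intro: step.lam)
next
  case (appl j t u f r)
  then obtain k' where "k = Suc k'" by (cases k) auto
  with appl show ?case by (blast elim!: parE intro: step.appl)
next
  case (appr j t u f r)
  then obtain k' where k: "k = Suc k'" by (cases k) auto
  with appr.prems obtain a b where s: "s = App a b" "par v False (if v then k else k') t b"
    by (auto elim: parE)
  from k appr.prems(2) have "j < (if v then k else k')" by (auto split: if_splits)
  with appr.IH[OF s(2)] s(1) show ?case by (blast intro: step.appr)
next
  case (opl j t u f r)
  then obtain k' where "k = Suc k'" "j < k'" by (cases k) auto
  with opl show ?case by (blast elim!: parE intro: step.opl)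
next
  case (opr j t u f r)
  then obtain k' where "k = Suc k'" "j < k'" by (cases k) auto
  with opr show ?case by (blast elim!: parE intro: step.opr)
qed

section \<open>Unfolding \<open>std\<close> and \<open>par\<close> into single steps of bounded
  level\<close>

abbreviation steps :: "bool \<Rightarrow> bool \<Rightarrow> nat \<Rightarrow> tm \<Rightarrow> tm \<Rightarrow> bool" where
  "steps v f k \<equiv> (\<lambda>t s. \<exists>j\<ge>k. step v f j t s)\<^sup>*\<^sup>*"

lemma rtranclp_map:
  assumes "r\<^sup>*\<^sup>* x y" and "\<And>x y. r x y \<Longrightarrow> r' (h x) (h y)"
  shows "r'\<^sup>*\<^sup>* (h x) (h y)"
  using assms(1) by induction (auto intro: rtranclp.rtrancl_into_rtrancl assms(2))

text \<open>The inequality between the bounds makes one congruence lemma serve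
  \<open>std_steps\<close>, where every bound is 0, and \<open>par_steps\<close>, where the bound
  may shift.\<close>

lemma steps_lam:
  assumes "steps v False k t s" "l \<le> (if v \<and> \<not> f then Suc k else k)"
  shows "steps v f l (Lam t) (Lam s)"
  using assms(1)
proof (rule rtranclp_map)
  fix x y assume "\<exists>j\<ge>k. step v False j x y"
  then obtain j where "j \<ge> k" "step v False j x y" by blast
  with step.lam[OF this(2), of f] assms(2) show "\<exists>j\<ge>l. step v f j (Lam x) (Lam y)"
    by (intro exI[of _ "if v \<and> \<not> f then Suc j else j"]) auto
qed

lemma steps_app:
  assumes "steps v True k t s" "steps v False l t' s'" "k \<le> (if v then l else Suc l)"
  shows "steps v f k (App t t') (App s s')"
proof (rule rtranclp_trans)
  show "steps v f k (App t t') (App s t')"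
    using assms(1) by (rule rtranclp_map) (blast intro: step.appl)
  show "steps v f k (App s t') (App s s')"
    using assms(2)
  proof (rule rtranclp_map)
    fix x y assume "\<exists>j\<ge>l. step v False j x y"
    then obtain j where "j \<ge> l" "step v False j x y" by blast
    with step.appr[OF this(2), of f s] assms(3) show "\<exists>j\<ge>k. step v f j (App s x) (App s y)"
      by (intro exI[of _ "if v then j else Suc j"]) auto
  qed
qed

lemma steps_op:
  assumes "steps v False k t s" "steps v False k t' s'" "l \<le> Suc k"
  shows "steps v f l (Op t t') (Op s s')"
proof (rule rtranclp_trans)
  show "steps v f l (Op t t') (Op s t')"
    using assms(1) by (rule rtranclp_map) (meson assms(3) step.opl Suc_le_mono order_trans)
  show "steps v f l (Op s t') (Op s s')"
    using assms(2) by (rule rtranclp_map) (meson assms(3) step.opr Suc_le_mono order_trans)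
qed

lemma std_steps: "std v n t s \<Longrightarrow> steps v f 0 t s"
proof (induction arbitrary: f rule: std.induct)
  case (root t u n s)
  show ?case
    by (rule converse_rtranclp_into_rtranclp[OF _ root.IH]) (use root.hyps in \<open>blast intro: step.root\<close>)
next
  case (lam n t s)
  from lam.IH show ?case by (rule steps_lam) simp
next
  case (app n t s m t' s')
  from app.IH show ?case by (rule steps_app) simp
next
  case (op n t s m t' s')
  from op.IH show ?case by (rule steps_op) simp
qed simp

lemma par_steps: "par v f k t s \<Longrightarrow> steps v f k t s"
proof (induction rule: par.induct)
  case (std n t s f)
  then show ?case by (rule std_steps)
next
  case (lam f k t s)
  from lam.IH show ?case by (rule steps_lam) simp
next
  case (app k t s t' s' f)
  from app.IH show ?case by (rule steps_app) simp
next
  case (op k t s t' s' f)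
  from op.IH show ?case by (rule steps_op) simp
qed simp

section \<open>Agreement of the inductive levels with the levels of contexts\<close>

lemma step_cbn_iff: "step_at plug cbn_level cbn_root j t s \<longleftrightarrow> step False f j t s"
proof
  have "step False f (cbn_level C) (plug C R) (plug C R')" if "cbn_root R R'" for C R R'
  \<comment> \<open>Generalized over \<open>f\<close>, since entering the function part of an
    application sets the flag.\<close>
  proof (induction C arbitrary: f)
    case Hole
    with that show ?case by (auto intro: step.root simp: root_def)
  next
    case (CLam C) then show ?case using step.lam[of False] by simp
  next
    case (CAppR t C) then show ?case using step.appr[of False] by simp
  qed (auto intro: step.intros)
  then show "step_at plug cbn_level cbn_root j t s \<Longrightarrow> step False f j t s"
    by (auto simp: step_at_def)
next
  assume "step False f j t s"
  then show "step_at plug cbn_level cbn_root j t s"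
    unfolding step_at_def
  proof (induction rule: step.induct)
    case (root t s f)
    then show ?case
      by (intro exI[of _ Hole] exI[of _ t] exI[of _ s]) (simp add: root_def)
  next
    case (lam k t s f)
    then show ?case by (metis plug.simps(2) cbn_level.simps(2))
  next
    case (appl k t s f u)
    then show ?case by (metis plug.simps(3) cbn_level.simps(3))
  next
    case (appr k t s f u)
    then show ?case by (metis plug.simps(4) cbn_level.simps(4))
  next
    case (opl k t s f u)
    then show ?case by (metis plug.simps(5) cbn_level.simps(5))
  next
    case (opr k t s f u)
    then show ?case by (metis plug.simps(6) cbn_level.simps(6))
  qed
qed

text \<open>The level of a context \<open>C\<close> placed in function position is that of \<open>CAppL C u\<close>, for any \<open>u\<close>.\<close>
lemma step_cbv_plug:
  assumes "cbv_root R R'"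
  shows "step True False (cbv_level C) (plug C R) (plug C R')
    \<and> step True True (cbv_level (CAppL C u)) (plug C R) (plug C R')"
proof (induction C arbitrary: u)
  case Hole
  with assms show ?case by (auto intro: step.root simp: root_def)
next
  \<comment> \<open>The abstraction costs a level on its own and none below \<open>CAppL\<close>;
    the two conjuncts are \<open>step.lam\<close> at the two values of \<open>f\<close>.\<close>
  case (CLam C)
  then show ?case
    using step.lam[of True "cbv_level C" "plug C R" "plug C R'"] by (metis cbv_level.simps(2,3) plug.simps(2))
next
  case (CAppL C t)
  then show ?case by (auto intro: step.appl)
next
  case (CAppR t C)
  then show ?case using step.appr[of True "cbv_level C" "plug C R" "plug C R'"] by simp
qed (auto intro: step.intros)

lemma step_cbv_ctx:
  assumes "step True f j t s"
  shows "\<exists>C R R'. t = plug C R \<and> s = plug C R' \<and> cbv_root R R' \<and>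
    (if f then cbv_level (CAppL C u) else cbv_level C) = j"
  using assms
proof (induction arbitrary: u rule: step.induct)
  case (root t s f)
  then show ?case
    by (intro exI[of _ Hole] exI[of _ t] exI[of _ s]) (simp add: root_def)
next
  case (lam k t s f)
  then obtain C R R' where "t = plug C R" "s = plug C R'" "cbv_root R R'" "cbv_level C = k" by auto
  then show ?case
    by (intro exI[of _ "CLam C"] exI[of _ R] exI[of _ R']) simp
next
  case (appl k t s f r)
  \<comment> \<open>The argument \<open>u\<close> of the induction hypothesis is taken to be the
    actual argument \<open>r\<close>.\<close>
  then obtain C R R' where "t = plug C R" "s = plug C R'" "cbv_root R R'" "cbv_level (CAppL C r) = k"
    by (metis (full_types))
  then show ?case
    by (intro exI[of _ "CAppL C r"] exI[of _ R] exI[of _ R']) simp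
next
  case (appr k t s f r)
  then obtain C R R' where "t = plug C R" "s = plug C R'" "cbv_root R R'" "cbv_level C = k" by auto
  then show ?case
    by (intro exI[of _ "CAppR r C"] exI[of _ R] exI[of _ R']) simp
next
  case (opl k t s f r)
  then obtain C R R' where "t = plug C R" "s = plug C R'" "cbv_root R R'" "cbv_level C = k" by auto
  then show ?case
    by (intro exI[of _ "COpL C r"] exI[of _ R] exI[of _ R']) simp
next
  case (opr k t s f r)
  then obtain C R R' where "t = plug C R" "s = plug C R'" "cbv_root R R'" "cbv_level C = k" by auto
  then show ?case
    by (intro exI[of _ "COpR r C"] exI[of _ R] exI[of _ R']) simp
qed

lemma step_cbv_iff: "step_at plug cbv_level cbv_root j t s \<longleftrightarrow> step True False j t s"
  using step_cbv_plug step_cbv_ctx[of False] unfolding step_at_def by (metis (full_types))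

text \<open>A whole term does not stand in function position, so the flag of \<open>par\<close>
  starts as \<open>False\<close>.\<close>

interpretation cbn: leveled_standardization plug cbn_level cbn_root "std False" "par False False"
  by unfold_locales
    (simp_all only: step_cbn_iff[where f = False] step_par par_std std_split par_merge par_persist par_steps)

interpretation cbv: leveled_standardization plug cbv_level cbv_root "std True" "par True False"
  by unfold_locales
    (simp_all only: step_cbv_iff step_par par_std std_split par_merge par_persist par_steps)


section \<open>The bang calculus\<close>

definition broot :: "btm \<Rightarrow> btm \<Rightarrow> bool" where
  "broot = bang_root"

lemma broot_iff:
  "broot t s \<longleftrightarrow> (\<exists>p q. t = BOp p q \<and> (s = p \<or> s = q)) \<or>
     (\<exists>p q. t = BApp (BLam p) (Bang q) \<and> s = bsubst p q 0)"
  by (auto simp: broot_def bang_oplus.simps bang_beta.simps)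

section \<open>De Bruijn substitution for bang terms\<close>

lemma blift_blift: "i < Suc k \<Longrightarrow> blift (blift t i) (Suc k) = blift (blift t k) i"
  by (induction t arbitrary: i k) auto

lemma blift_bsubst:
  "j < Suc i \<Longrightarrow> blift (bsubst t s j) i = bsubst (blift t (Suc i)) (blift s i) j"
  by (induction t arbitrary: i j s) (simp_all add: diff_Suc blift_blift split: nat.split)

lemma blift_bsubst_lt:
  "i < Suc j \<Longrightarrow> blift (bsubst t s j) i = bsubst (blift t i) (blift s i) (Suc j)"
  by (induction t arbitrary: i j s) (auto simp: blift_blift)

lemma bsubst_blift: "bsubst (blift t k) s k = t"
  by (induction t arbitrary: k s) simp_all

lemma bsubst_bsubst:
  "i < Suc j \<Longrightarrow>
     bsubst (bsubst t (blift q i) (Suc j)) (bsubst p q j) i = bsubst (bsubst t p i) q j"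
  by (induction t arbitrary: i j p q)
    (simp_all add: diff_Suc bsubst_blift blift_blift[symmetric] blift_bsubst_lt split: nat.split)

lemma broot_blift: "broot t s \<Longrightarrow> broot (blift t k) (blift s k)"
  unfolding broot_iff by (auto simp: blift_bsubst)

text \<open>The argument of a redex is recognized by its outermost \<open>Bang\<close>, which every
  substitution preserves; hence \<open>q\<close> is arbitrary.\<close>

lemma broot_bsubst: "broot t s \<Longrightarrow> broot (bsubst t q k) (bsubst s q k)"
  unfolding broot_iff
  by (elim disjE exE conjE) (simp_all add: bsubst_bsubst[where i = 0, symmetric])

inductive bstep :: "nat \<Rightarrow> btm \<Rightarrow> btm \<Rightarrow> bool" where
  root: "broot t s \<Longrightarrow> bstep 0 t s"
| lam: "bstep k t s \<Longrightarrow> bstep k (BLam t) (BLam s)"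
| appl: "bstep k t s \<Longrightarrow> bstep k (BApp t u) (BApp s u)"
| appr: "bstep k t s \<Longrightarrow> bstep k (BApp u t) (BApp u s)"
| bang: "bstep k t s \<Longrightarrow> bstep (Suc k) (Bang t) (Bang s)"
| opl: "bstep k t s \<Longrightarrow> bstep (Suc k) (BOp t u) (BOp s u)"
| opr: "bstep k t s \<Longrightarrow> bstep (Suc k) (BOp u t) (BOp u s)"

inductive bstd :: "nat \<Rightarrow> btm \<Rightarrow> btm \<Rightarrow> bool" where
  root: "broot t u \<Longrightarrow> bstd n u s \<Longrightarrow> bstd (Suc n) t s"
| var: "bstd 0 (BVar i) (BVar i)"
| lam: "bstd n t s \<Longrightarrow> bstd n (BLam t) (BLam s)"
| app: "bstd n t s \<Longrightarrow> bstd m t' s' \<Longrightarrow> bstd (n + m) (BApp t t') (BApp s s')"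
| bang: "bstd n t s \<Longrightarrow> bstd n (Bang t) (Bang s)"
| op: "bstd n t s \<Longrightarrow> bstd m t' s' \<Longrightarrow> bstd (n + m) (BOp t t') (BOp s s')"

text \<open>Only \<open>Bang\<close> and \<open>BOp\<close> spend the bound; under abstractions and
  on both sides of an application it stays positive and keeps excluding root contractions.\<close>

inductive bpar :: "nat \<Rightarrow> btm \<Rightarrow> btm \<Rightarrow> bool" where
  std: "bstd n t s \<Longrightarrow> bpar 0 t s"
| var: "bpar (Suc k) (BVar i) (BVar i)"
| lam: "bpar (Suc k) t s \<Longrightarrow> bpar (Suc k) (BLam t) (BLam s)"
| app: "bpar (Suc k) t s \<Longrightarrow> bpar (Suc k) t' s' \<Longrightarrow> bpar (Suc k) (BApp t t') (BApp s s')"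
| bang: "bpar k t s \<Longrightarrow> bpar (Suc k) (Bang t) (Bang s)"
| op: "bpar k t s \<Longrightarrow> bpar k t' s' \<Longrightarrow> bpar (Suc k) (BOp t t') (BOp s s')"

inductive_cases bparE:
  "bpar (Suc k) (BVar i) s" "bpar (Suc k) (BLam t) s" "bpar (Suc k) (BApp t t') s"
  "bpar (Suc k) (Bang t) s" "bpar (Suc k) (BOp t t') s"
  "bpar (Suc k) t (BVar i)" "bpar (Suc k) t (BLam s)" "bpar (Suc k) t (BApp s s')"
  "bpar (Suc k) t (Bang s)" "bpar (Suc k) t (BOp s s')"

section \<open>Reflexivity and inclusions for bang reductions\<close>

lemma bstd_refl: "bstd 0 t t"
  by (induction t) (auto intro: bstd.intros bstd.app[where n = 0 and m = 0, simplified]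
      bstd.op[where n = 0 and m = 0, simplified])

lemma bpar_refl: "bpar k t t"
proof (induction t arbitrary: k)
  case (BVar i) show ?case by (cases k) (use BVar in \<open>blast intro: bpar.intros bstd_refl\<close>)+
next
  case (BLam t) show ?case by (cases k) (use BLam in \<open>blast intro: bpar.intros bstd_refl\<close>)+
next
  case (BApp t t') show ?case by (cases k) (use BApp in \<open>blast intro: bpar.intros bstd_refl\<close>)+
next
  case (Bang t) show ?case by (cases k) (use Bang in \<open>blast intro: bpar.intros bstd_refl\<close>)+
next
  case (BOp t t') show ?case by (cases k) (use BOp in \<open>blast intro: bpar.intros bstd_refl\<close>)+
qed

lemma bstep_bstd: "bstep k t s \<Longrightarrow> \<exists>n. bstd n t s"
  by (induction rule: bstep.induct) (blast intro: bstd.intros bstd_refl)+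

lemma bpar_bstd: "bpar k t s \<Longrightarrow> \<exists>n. bstd n t s"
  by (induction rule: bpar.induct) (blast intro: bstd.intros)+

lemma bstep_bpar: "bstep j t s \<Longrightarrow> k \<le> j \<Longrightarrow> bpar k t s"
proof (induction arbitrary: k rule: bstep.induct)
  case (root t s)
  then show ?case using bstep_bstd[OF bstep.root[OF root.hyps]] by (auto intro: bpar.std)
next
  case (lam j t s)
  show ?case
  proof (cases k)
    case 0 with bstep_bstd[OF bstep.lam[OF lam.hyps]] show ?thesis by (blast intro: bpar.std)
  next
    case Suc with lam show ?thesis by (blast intro: bpar.lam)
  qed
next
  case (appl j t s u)
  show ?case
  proof (cases k)
    case 0 with bstep_bstd[OF bstep.appl[OF appl.hyps]] show ?thesis by (blast intro: bpar.std)
  next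
    case Suc with appl show ?thesis by (blast intro: bpar.app bpar_refl)
  qed
next
  case (appr j t s u)
  show ?case
  proof (cases k)
    case 0 with bstep_bstd[OF bstep.appr[OF appr.hyps]] show ?thesis by (blast intro: bpar.std)
  next
    case Suc with appr show ?thesis by (blast intro: bpar.app bpar_refl)
  qed
next
  case (bang j t s)
  show ?case
  proof (cases k)
    case 0 with bstep_bstd[OF bstep.bang[OF bang.hyps]] show ?thesis by (blast intro: bpar.std)
  next
    case Suc with bang show ?thesis by (auto intro!: bpar.bang)
  qed
next
  case (opl j t s u)
  show ?case
  proof (cases k)
    case 0 with bstep_bstd[OF bstep.opl[OF opl.hyps]] show ?thesis by (blast intro: bpar.std)
  next
    case Suc with opl show ?thesis by (auto intro!: bpar.op bpar_refl)
  qed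
next
  case (opr j t s u)
  show ?case
  proof (cases k)
    case 0 with bstep_bstd[OF bstep.opr[OF opr.hyps]] show ?thesis by (blast intro: bpar.std)
  next
    case Suc with opr show ?thesis by (auto intro!: bpar.op bpar_refl)
  qed
qed

section \<open>Substitutivity, splitting and merging of bang reductions\<close>

lemma bstd_blift: "bstd n t s \<Longrightarrow> bstd n (blift t k) (blift s k)"
proof (induction arbitrary: k rule: bstd.induct)
  case (root t u n s)
  then show ?case by (blast intro: bstd.root broot_blift)
qed (auto intro: bstd.intros)

lemma bstd_bsubst:
  "bstd n t s \<Longrightarrow> bstd m q q' \<Longrightarrow> \<exists>l. bstd l (bsubst t q k) (bsubst s q' k)"
proof (induction arbitrary: k q q' rule: bstd.induct)
  case (root t u n s)
  then show ?case by (blast intro: bstd.root broot_bsubst)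
next
  case (var i)
  then show ?case by (auto intro: bstd.var)
next
  case (lam n t s)
  from lam.IH[OF bstd_blift[OF lam.prems]] show ?case by (simp; blast intro: bstd.lam)
next
  case (app n t s m t' s')
  then show ?case by (simp; blast intro: bstd.app)
next
  case (bang n t s)
  then show ?case by (simp; blast intro: bstd.bang)
next
  case (op n t s m t' s')
  then show ?case by (simp; blast intro: bstd.op)
qed

lemma bstd_split:
  "bstd n t s \<Longrightarrow> bpar k t s \<or> (\<exists>j<k. \<exists>u. bstep j t u \<and> (\<exists>m<n. bstd m u s))"
proof (induction arbitrary: k rule: bstd.induct)
  case (root t u n s)
  show ?case
  proof (cases k)
    case 0 then show ?thesis using bstd.root[OF root.hyps] by (auto intro: bpar.std)
  next
    case Suc with root.hyps show ?thesis by (blast intro: bstep.root)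
  qed
next
  case (var i)
  show ?case using bpar_refl by blast
next
  case (lam n t s)
  show ?case
  proof (cases k)
    case 0 then show ?thesis using bstd.lam[OF lam.hyps] by (auto intro: bpar.std)
  next
    case (Suc k')
    with lam.IH[of k] show ?thesis by (blast intro: bpar.lam bstep.lam bstd.lam)
  qed
next
  case (app n t s m t' s')
  show ?case
  proof (cases k)
    case 0 then show ?thesis using bstd.app[OF app.hyps] by (auto intro: bpar.std)
  next
    case (Suc k')
    from app.IH[of k]
    consider "bpar k t s" "bpar k t' s'"
      | j u l where "j < k" "bstep j t u" "l < n" "bstd l u s"
      | j u l where "j < k" "bstep j t' u" "l < m" "bstd l u s'"
      by blast
    then show ?thesis
    proof cases
      case 1
      with Suc show ?thesis by (auto intro: bpar.app)
    next
      case 2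
      then have "l + m < n + m" by simp
      with 2 app.hyps(2) show ?thesis by (blast intro: bstep.appl bstd.app)
    next
      case 3
      then have "n + l < n + m" by simp
      with 3 app.hyps(1) show ?thesis by (blast intro: bstep.appr bstd.app)
    qed
  qed
next
  case (bang n t s)
  show ?case
  proof (cases k)
    case 0 then show ?thesis using bstd.bang[OF bang.hyps] by (auto intro: bpar.std)
  next
    case (Suc k')
    \<comment> \<open>\<open>Bang\<close> adds one level, so the body is split at the predecessor of
      \<open>k\<close>.\<close>
    with bang.IH[of k'] show ?thesis
      by (meson Suc_less_eq bpar.bang bstd.bang bstep.bang)
  qed
next
  case (op n t s m t' s')
  show ?case
  proof (cases k)
    case 0 then show ?thesis using bstd.op[OF op.hyps] by (auto intro: bpar.std)
  next
    case (Suc k')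
    from op.IH[of k']
    consider "bpar k' t s" "bpar k' t' s'"
      | j u l where "j < k'" "bstep j t u" "l < n" "bstd l u s"
      | j u l where "j < k'" "bstep j t' u" "l < m" "bstd l u s'"
      by blast
    then show ?thesis
    proof cases
      case 1
      with Suc show ?thesis by (auto intro: bpar.op)
    next
      case 2
      then have "l + m < n + m" "Suc j < k" using Suc by auto
      with 2 op.hyps(2) show ?thesis by (blast intro: bstep.opl bstd.op)
    next
      case 3
      then have "n + l < n + m" "Suc j < k" using Suc by auto
      with 3 op.hyps(1) show ?thesis by (blast intro: bstep.opr bstd.op)
    qed
  qed
qed

lemma bpar_merge:
  "bstep j s u \<Longrightarrow> bpar k t s \<Longrightarrow> j < k \<Longrightarrow> \<exists>n. bstd n t u"
proof (induction arbitrary: t k rule: bstep.induct)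
  case (root s u)
  then obtain k' where k: "k = Suc k'" by (cases k) auto
  from root.hyps consider p q where "s = BOp p q" "u = p \<or> u = q"
    | p q where "s = BApp (BLam p) (Bang q)" "u = bsubst p q 0"
    unfolding broot_iff by blast
  then show ?case
  proof cases
    case 1
    with root.prems k obtain p' q' where t: "t = BOp p' q'" "bpar k' p' p" "bpar k' q' q"
      by (auto elim: bparE)
    have "broot t p'" "broot t q'" unfolding broot_iff by (simp_all add: t(1))
    with 1 bpar_bstd[OF t(2)] bpar_bstd[OF t(3)] show ?thesis by (blast intro: bstd.root)
  next
    case 2
    \<comment> \<open>The \<open>Bang\<close> sits at the level of the redex and is fixed by the
      positive bound; its content only has bound \<open>k'\<close>, so for \<open>k' = 0\<close> it
      may reduce freely.\<close>
    with root.prems k obtain p' q' where t: "t = BApp (BLam p') (Bang q')"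
      "bpar k p' p" "bpar k' q' q"
      by (auto elim!: bparE)
    then have "broot t (bsubst p' q' 0)" unfolding broot_iff by simp
    moreover obtain m where "bstd m (bsubst p' q' 0) (bsubst p q 0)"
      using bpar_bstd[OF t(2)] bpar_bstd[OF t(3)] bstd_bsubst by blast
    ultimately show ?thesis using 2(2) by (blast intro: bstd.root)
  qed
next
  case (lam j s u)
  then obtain k' where "k = Suc k'" by (cases k) auto
  with lam show ?case by (blast elim!: bparE intro: bstd.lam)
next
  case (appl j s u r)
  then obtain k' where "k = Suc k'" by (cases k) auto
  with appl show ?case by (blast elim!: bparE intro: bstd.app dest: bpar_bstd)
next
  case (appr j s u r)
  then obtain k' where "k = Suc k'" by (cases k) auto
  with appr show ?case by (blast elim!: bparE intro: bstd.app dest: bpar_bstd)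
next
  case (bang j s u)
  then obtain k' where "k = Suc k'" "j < k'" by (cases k) auto
  with bang show ?case by (blast elim!: bparE intro: bstd.bang)
next
  case (opl j s u r)
  then obtain k' where "k = Suc k'" "j < k'" by (cases k) auto
  with opl show ?case by (blast elim!: bparE intro: bstd.op dest: bpar_bstd)
next
  case (opr j s u r)
  then obtain k' where "k = Suc k'" "j < k'" by (cases k) auto
  with opr show ?case by (blast elim!: bparE intro: bstd.op dest: bpar_bstd)
qed

text \<open>The constructors that make up a redex all sit at its own level, so contractions of
  higher level happen strictly inside its components.\<close>

lemma bpar_persist:
  "bstep j t u \<Longrightarrow> bpar k t s \<Longrightarrow> j < k \<Longrightarrow> \<exists>u'. bstep j s u'"
proof (induction arbitrary: s k rule: bstep.induct)
  case (root t u)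
  then obtain k' where k: "k = Suc k'" by (cases k) auto
  with root.hyps root.prems(1) have "\<exists>u'. broot s u'"
    unfolding broot_iff by (auto elim!: bparE)
  then show ?case by (blast intro: bstep.root)
next
  case (lam j t u)
  then obtain k' where "k = Suc k'" by (cases k) auto
  with lam show ?case by (blast elim!: bparE intro: bstep.lam)
next
  case (appl j t u r)
  then obtain k' where "k = Suc k'" by (cases k) auto
  with appl show ?case by (blast elim!: bparE intro: bstep.appl)
next
  case (appr j t u r)
  then obtain k' where "k = Suc k'" by (cases k) auto
  with appr show ?case by (blast elim!: bparE intro: bstep.appr)
next
  case (bang j t u)
  then obtain k' where "k = Suc k'" "j < k'" by (cases k) auto
  with bang show ?case by (blast elim!: bparE intro: bstep.bang)
next
  case (opl j t u r)
  then obtain k' where "k = Suc k'" "j < k'" by (cases k) auto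
  with opl show ?case by (blast elim!: bparE intro: bstep.opl)
next
  case (opr j t u r)
  then obtain k' where "k = Suc k'" "j < k'" by (cases k) auto
  with opr show ?case by (blast elim!: bparE intro: bstep.opr)
qed

section \<open>Unfolding bang reductions into single steps\<close>

abbreviation bsteps :: "nat \<Rightarrow> btm \<Rightarrow> btm \<Rightarrow> bool" where
  "bsteps k \<equiv> (\<lambda>t s. \<exists>j\<ge>k. bstep j t s)\<^sup>*\<^sup>*"

lemma bsteps_lam: "bsteps k t s \<Longrightarrow> bsteps k (BLam t) (BLam s)"
  by (erule rtranclp_map) (blast intro: bstep.lam)

lemma bsteps_app:
  assumes "bsteps k t s" "bsteps k t' s'"
  shows "bsteps k (BApp t t') (BApp s s')"
proof (rule rtranclp_trans)
  show "bsteps k (BApp t t') (BApp s t')"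
    using assms(1) by (rule rtranclp_map) (blast intro: bstep.appl)
  show "bsteps k (BApp s t') (BApp s s')"
    using assms(2) by (rule rtranclp_map) (blast intro: bstep.appr)
qed

lemma bsteps_bang:
  assumes "bsteps k t s" "l \<le> Suc k"
  shows "bsteps l (Bang t) (Bang s)"
  using assms(1) by (rule rtranclp_map) (meson assms(2) bstep.bang Suc_le_mono order_trans)

lemma bsteps_op:
  assumes "bsteps k t s" "bsteps k t' s'" "l \<le> Suc k"
  shows "bsteps l (BOp t t') (BOp s s')"
proof (rule rtranclp_trans)
  show "bsteps l (BOp t t') (BOp s t')"
    using assms(1) by (rule rtranclp_map) (meson assms(3) bstep.opl Suc_le_mono order_trans)
  show "bsteps l (BOp s t') (BOp s s')"
    using assms(2) by (rule rtranclp_map) (meson assms(3) bstep.opr Suc_le_mono order_trans)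
qed

lemma bstd_bsteps: "bstd n t s \<Longrightarrow> bsteps 0 t s"
proof (induction rule: bstd.induct)
  case (root t u n s)
  show ?case
    by (rule converse_rtranclp_into_rtranclp[OF _ root.IH])
      (use bstep.root[OF root.hyps(1)] in blast)
next
  case (lam n t s)
  from lam.IH show ?case by (rule bsteps_lam)
next
  case (app n t s m t' s')
  from app.IH show ?case by (rule bsteps_app)
next
  case (bang n t s)
  from bang.IH show ?case by (rule bsteps_bang) simp
next
  case (op n t s m t' s')
  from op.IH show ?case by (rule bsteps_op) simp
qed simp

lemma bpar_bsteps: "bpar k t s \<Longrightarrow> bsteps k t s"
proof (induction rule: bpar.induct)
  case (std n t s)
  then show ?case by (rule bstd_bsteps)
next
  case (lam k t s)
  from lam.IH show ?case by (rule bsteps_lam)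
next
  case (app k t s t' s')
  from app.IH show ?case by (rule bsteps_app)
next
  case (bang k t s)
  from bang.IH show ?case by (rule bsteps_bang) simp
next
  case (op k t s t' s')
  from op.IH show ?case by (rule bsteps_op) simp
qed simp

section \<open>Agreement with the levels of bang contexts\<close>

lemma bstep_iff: "step_at bplug bang_level bang_root j t s \<longleftrightarrow> bstep j t s"
proof
  have "bstep (bang_level C) (bplug C R) (bplug C R')" if "bang_root R R'" for C R R'
    proof (induction C)
    case BHole
    with that show ?case by (auto intro: bstep.root simp: broot_def)
  qed (auto intro: bstep.intros)
  then show "step_at bplug bang_level bang_root j t s \<Longrightarrow> bstep j t s"
    unfolding step_at_def by blast
next
  assume "bstep j t s"
  then show "step_at bplug bang_level bang_root j t s"
    unfolding step_at_def
  proof (induction rule: bstep.induct)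
    case (root t s)
    then show ?case by (intro exI[of _ BHole] exI[of _ t] exI[of _ s]) (simp add: broot_def)
  next
    case (lam k t s)
    then show ?case by (metis bplug.simps(2) bang_level.simps(2))
  next
    case (appl k t s u)
    then show ?case by (metis bplug.simps(3) bang_level.simps(3))
  next
    case (appr k t s u)
    then show ?case by (metis bplug.simps(4) bang_level.simps(4))
  next
    case (bang k t s)
    then show ?case by (metis bplug.simps(5) bang_level.simps(5))
  next
    case (opl k t s u)
    then show ?case by (metis bplug.simps(6) bang_level.simps(6))
  next
    case (opr k t s u)
    then show ?case by (metis bplug.simps(7) bang_level.simps(7))
  qed
qed

interpretation bang: leveled_standardization bplug bang_level bang_root bstd bpar
  by unfold_locales
    (simp_all only: bstep_iff bstep_bpar bpar_bstd bstd_split bpar_merge bpar_persist bpar_bsteps)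

theorem theorem5:
  shows "ll_factorization bang_red
           (ll_step bplug bang_level bang_root) (internal_step bplug bang_level bang_root) \<and>
         ll_factorization cbn_red
           (ll_step plug cbn_level cbn_root) (internal_step plug cbn_level cbn_root) \<and>
         ll_factorization cbv_red
           (ll_step plug cbv_level cbv_root) (internal_step plug cbv_level cbv_root)"
  \<comment> \<open>The union of the two closures becomes the closure of the union, the form in
    which the locale proves factorization.\<close>
  unfolding bang_red_def cbn_red_def cbv_red_def ctx_closure_sup
  using bang.factorization cbn.factorization cbv.factorization by blast

end
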